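(* There exists a Buchsteiner loop of order $32$ that is not conjugacy closed.
   Context: A Buchsteiner loop is a loop satisfying $x\backslash (xy\cdot z) = (y\cdot zx)/x$ for all $x,y,z$, where $\backslash$ and $/$ are left and right division. A loop is conjugacy closed if for all $x,y$ the conjugate $L_xL_yL_x^{-1}$ is a left translation and $R_xR_yR_x^{-1}$ is a right translation, where $L_x(y)=xy$, $R_x(y)=yx$. *)

theory Defs
  imports "HOL-Algebra.Bij" "HOL-Algebra.Coset"
begin

locale loop =
  fixes Q :: "('a, 'b) monoid_scheme" (structure)
  assumes m_closed: "\<lbrakk>x \<in> carrier Q; y \<in> carrier Q\<rbrakk> \<Longrightarrow> x \<otimes> y \<in> carrier Q"
    and one_closed: "\<one> \<in> carrier Q"
    and l_one: "x \<in> carrier Q \<Longrightarrow> \<one> \<otimes> x = x"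
    and r_one: "x \<in> carrier Q \<Longrightarrow> x \<otimes> \<one> = x"
    and l_division: "\<lbrakk>a \<in> carrier Q; b \<in> carrier Q\<rbrakk> \<Longrightarrow> \<exists>!x. x \<in> carrier Q \<and> a \<otimes> x = b"
    and r_division: "\<lbrakk>a \<in> carrier Q; b \<in> carrier Q\<rbrakk> \<Longrightarrow> \<exists>!x. x \<in> carrier Q \<and> x \<otimes> a = b"

text \<open>\<open>ldiv Q a b\<close> is $a \backslash b$, whereas \<open>rdiv Q b a\<close> is $b / a$.\<close>

definition ldiv :: "('a, 'b) monoid_scheme \<Rightarrow> 'a \<Rightarrow> 'a \<Rightarrow> 'a"
  where "ldiv Q a b = (THE x. x \<in> carrier Q \<and> a \<otimes>\<^bsub>Q\<^esub> x = b)"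

definition rdiv :: "('a, 'b) monoid_scheme \<Rightarrow> 'a \<Rightarrow> 'a \<Rightarrow> 'a"
  where "rdiv Q b a = (THE x. x \<in> carrier Q \<and> x \<otimes>\<^bsub>Q\<^esub> a = b)"

locale buchsteiner_loop = loop +
  assumes buchsteiner:
    "\<lbrakk>x \<in> carrier Q; y \<in> carrier Q; z \<in> carrier Q\<rbrakk> \<Longrightarrow>
      ldiv Q x ((x \<otimes> y) \<otimes> z) = rdiv Q (y \<otimes> (z \<otimes> x)) x"

text \<open>Translations are restricted to the carrier, so that they are elements of
  \<open>BijGroup (carrier Q)\<close>, in which the product is composition of maps acting on the left.\<close>

definition left_translation :: "('a, 'b) monoid_scheme \<Rightarrow> 'a \<Rightarrow> 'a \<Rightarrow> 'a"
  where "left_translation Q x = (\<lambda>y \<in> carrier Q. x \<otimes>\<^bsub>Q\<^esub> y)"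

definition right_translation :: "('a, 'b) monoid_scheme \<Rightarrow> 'a \<Rightarrow> 'a \<Rightarrow> 'a"
  where "right_translation Q x = (\<lambda>y \<in> carrier Q. y \<otimes>\<^bsub>Q\<^esub> x)"

lemma (in loop) left_translation_in_BijGroup:
  assumes "x \<in> carrier Q"
  shows "left_translation Q x \<in> carrier (BijGroup (carrier Q))"
proof -
  have "bij_betw (\<lambda>y. x \<otimes> y) (carrier Q) (carrier Q)"
    using l_division[OF assms] m_closed[OF assms]
    by (auto simp: bij_betw_def inj_on_def image_iff) metis+
  then show ?thesis
    by (simp add: BijGroup_def Bij_def left_translation_def cong: bij_betw_cong)
qed

lemma (in loop) right_translation_in_BijGroup:
  assumes "x \<in> carrier Q"
  shows "right_translation Q x \<in> carrier (BijGroup (carrier Q))"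
proof -
  have "bij_betw (\<lambda>y. y \<otimes> x) (carrier Q) (carrier Q)"
    using r_division[OF assms] m_closed[OF _ assms]
    by (auto simp: bij_betw_def inj_on_def image_iff) metis+
  then show ?thesis
    by (simp add: BijGroup_def Bij_def right_translation_def cong: bij_betw_cong)
qed

locale conjugacy_closed_loop = loop +
  assumes left_conjugacy_closed:
    "\<lbrakk>x \<in> carrier Q; y \<in> carrier Q\<rbrakk> \<Longrightarrow>
      left_translation Q x \<otimes>\<^bsub>BijGroup (carrier Q)\<^esub> left_translation Q y
        \<otimes>\<^bsub>BijGroup (carrier Q)\<^esub> inv\<^bsub>BijGroup (carrier Q)\<^esub> left_translation Q x
      \<in> left_translation Q ` carrier Q"
    and right_conjugacy_closed:
    "\<lbrakk>x \<in> carrier Q; y \<in> carrier Q\<rbrakk> \<Longrightarrow>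
      right_translation Q x \<otimes>\<^bsub>BijGroup (carrier Q)\<^esub> right_translation Q y
        \<otimes>\<^bsub>BijGroup (carrier Q)\<^esub> inv\<^bsub>BijGroup (carrier Q)\<^esub> right_translation Q x
      \<in> right_translation Q ` carrier Q"

end

theory Submission
  imports Defs "HOL-Library.Z2"
begin

text \<open>
  The loop is a central extension of a group \<open>G\<close> by the field with two elements. On pairs \<open>(x, a)\<close>
  with \<open>x\<close> in \<open>G\<close> the product is \<open>(x, a)(y, b) = (xy, a + b + f(x, y))\<close>, and the two ways of
  bracketing a triple product differ by the coboundary \<open>\<alpha>(x, y, z)\<close> of \<open>f\<close>. As \<open>\<alpha>\<close> takes central
  values, both laws become conditions on \<open>\<alpha>\<close> alone. The Buchsteiner law holds as soon as
  \<open>\<alpha>(x, y, z) = - \<alpha>(y, z, x)\<close> (\<open>buchsteiner_loop_extension\<close>); in characteristic 2 this says that \<open>\<alpha>\<close> is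
  invariant under cyclic shifts. Conjugacy closedness forces
  \<open>\<alpha>(x, y, z) = \<alpha>(xyx\<^sup>-\<^sup>1, x, z)\<close> (\<open>associator_conjugate\<close>). If \<open>\<alpha>\<close> depends only on the images of its
  arguments in an abelian quotient, this is symmetry in the first two arguments. So it is enough to
  find an \<open>\<alpha>\<close> that is cyclic but not symmetric.

  The simplest candidate is the trilinear form \<open>a b' c'' + b c' a'' + c a' b''\<close> on triples of bits.
  It is not a coboundary on the elementary abelian group of order 8: up to coboundaries it is three
  times the cup product of the three coordinate functions, which is a nonzero class. It becomes one on
  a group in which the cup product of two of these functions vanishes. Take for \<open>G\<close> the direct
  product of the dihedral group of order 8 and a group of order 2, with bits \<open>(a, b, c, d)\<close> and
  \<open>d(xy) = d(x) + d(y) + a(x) b(y)\<close>; then \<open>a b'\<close> is the coboundary of \<open>d\<close>. Since \<open>G\<close> has order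
  16, the extension has order 32.
\<close>

section \<open>Division-free forms of the two laws\<close>

lemma (in loop) ldiv_equality:
  assumes "a \<in> carrier Q" "x \<in> carrier Q" "a \<otimes> x = b"
  shows "ldiv Q a b = x"
  unfolding ldiv_def using assms l_division[of a b] m_closed
  by (intro the1_equality) auto

lemma (in loop) rdiv_equality:
  assumes "a \<in> carrier Q" "x \<in> carrier Q" "x \<otimes> a = b"
  shows "rdiv Q b a = x"
  unfolding rdiv_def using assms r_division[of a b] m_closed
  by (intro the1_equality) auto

lemma (in loop) buchsteiner_loopI:
  assumes "\<And>x y z. \<lbrakk>x \<in> carrier Q; y \<in> carrier Q; z \<in> carrier Q\<rbrakk> \<Longrightarrow>
    \<exists>w \<in> carrier Q. x \<otimes> w = (x \<otimes> y) \<otimes> z \<and> w \<otimes> x = y \<otimes> (z \<otimes> x)"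
  shows "buchsteiner_loop Q"
proof (intro buchsteiner_loop.intro buchsteiner_loop_axioms.intro)
  show "loop Q" by (rule loop_axioms)
next
  fix x y z assume xyz: "x \<in> carrier Q" "y \<in> carrier Q" "z \<in> carrier Q"
  then obtain w where "w \<in> carrier Q" "x \<otimes> w = (x \<otimes> y) \<otimes> z" "w \<otimes> x = y \<otimes> (z \<otimes> x)"
    using assms by blast
  then show "ldiv Q x ((x \<otimes> y) \<otimes> z) = rdiv Q (y \<otimes> (z \<otimes> x)) x"
    using xyz by (simp add: ldiv_equality rdiv_equality)
qed

text \<open>
  The witness \<open>w\<close> is the common value of the two divisions in the Buchsteiner law. In this form the
  law involves only products, so it passes along isomorphisms directly.
\<close>

lemma (in buchsteiner_loop) buchsteiner_witness:
  assumes "x \<in> carrier Q" "y \<in> carrier Q" "z \<in> carrier Q"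
  shows "\<exists>w \<in> carrier Q. x \<otimes> w = (x \<otimes> y) \<otimes> z \<and> w \<otimes> x = y \<otimes> (z \<otimes> x)"
proof -
  obtain w where w: "w \<in> carrier Q" "x \<otimes> w = (x \<otimes> y) \<otimes> z"
    using assms l_division[of x "(x \<otimes> y) \<otimes> z"] by (auto simp: m_closed)
  obtain w' where w': "w' \<in> carrier Q" "w' \<otimes> x = y \<otimes> (z \<otimes> x)"
    using assms r_division[of x "y \<otimes> (z \<otimes> x)"] by (auto simp: m_closed)
  have "w = w'"
    using buchsteiner[OF assms] assms w w' by (simp add: ldiv_equality rdiv_equality)
  with w w' show ?thesis by blast
qed

text \<open>
  \<open>L\<^sub>x L\<^sub>y L\<^sub>x\<^sup>-\<^sup>1 = L\<^sub>w\<close> amounts to \<open>L\<^sub>x L\<^sub>y = L\<^sub>w L\<^sub>x\<close>, an equation without inverses.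
\<close>

lemma (in conjugacy_closed_loop) left_conjugate:
  assumes x: "x \<in> carrier Q" and y: "y \<in> carrier Q"
  shows "\<exists>w \<in> carrier Q. \<forall>z \<in> carrier Q. x \<otimes> (y \<otimes> z) = w \<otimes> (x \<otimes> z)"
proof -
  let ?B = "BijGroup (carrier Q)" and ?L = "left_translation Q"
  interpret B: group ?B by (rule group_BijGroup)
  obtain w where w: "w \<in> carrier Q"
    and eq: "?L x \<otimes>\<^bsub>?B\<^esub> ?L y \<otimes>\<^bsub>?B\<^esub> inv\<^bsub>?B\<^esub> ?L x = ?L w"
    using left_conjugacy_closed[OF x y] by auto
  note L = left_translation_in_BijGroup
  have "?L x \<otimes>\<^bsub>?B\<^esub> ?L y = ?L w \<otimes>\<^bsub>?B\<^esub> ?L x"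
    using B.inv_solve_right'[of "?L w" "?L x \<otimes>\<^bsub>?B\<^esub> ?L y" "?L x"] L[OF x] L[OF y] L[OF w] eq
    by (simp add: B.m_assoc)
  then have "compose (carrier Q) (?L x) (?L y) = compose (carrier Q) (?L w) (?L x)"
    using L[OF x] L[OF y] L[OF w] by (simp add: BijGroup_def)
  then have "compose (carrier Q) (?L x) (?L y) z = compose (carrier Q) (?L w) (?L x) z" for z
    by simp
  then have "x \<otimes> (y \<otimes> z) = w \<otimes> (x \<otimes> z)" if "z \<in> carrier Q" for z
    using x y w that m_closed by (metis compose_eq left_translation_def restrict_apply')
  with w show ?thesis by blast
qed


section \<open>Relabelling the elements of a loop\<close>

text \<open>
  The unique structure on the image of the carrier for which \<open>h\<close>, if injective there, is an
  isomorphism. It carries a loop of pairs of bits over to natural numbers.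
\<close>

definition relabel :: "('a \<Rightarrow> 'b) \<Rightarrow> 'a monoid \<Rightarrow> 'b monoid"
  where "relabel h Q =
    \<lparr>carrier = h ` carrier Q,
     mult = \<lambda>u v. h (inv_into (carrier Q) h u \<otimes>\<^bsub>Q\<^esub> inv_into (carrier Q) h v),
     one = h \<one>\<^bsub>Q\<^esub>\<rparr>"

lemma carrier_relabel [simp]: "carrier (relabel h Q) = h ` carrier Q"
  and one_relabel [simp]: "\<one>\<^bsub>relabel h Q\<^esub> = h \<one>\<^bsub>Q\<^esub>"
  by (simp_all add: relabel_def)

lemma mult_relabel [simp]:
  assumes "inj_on h (carrier Q)" "x \<in> carrier Q" "y \<in> carrier Q"
  shows "h x \<otimes>\<^bsub>relabel h Q\<^esub> h y = h (x \<otimes>\<^bsub>Q\<^esub> y)"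
  using assms by (simp add: relabel_def)

lemma order_relabel: "inj_on h (carrier Q) \<Longrightarrow> order (relabel h Q) = order Q"
  by (simp add: order_def card_image)

lemma ex1_image_iff:
  assumes "inj_on h A"
  shows "(\<exists>!u. u \<in> h ` A \<and> P u) \<longleftrightarrow> (\<exists>!x. x \<in> A \<and> P (h x))"
proof
  assume "\<exists>!x. x \<in> A \<and> P (h x)"
  then show "\<exists>!u. u \<in> h ` A \<and> P u" by blast
next
  assume *: "\<exists>!u. u \<in> h ` A \<and> P u"
  then obtain x where "x \<in> A" "P (h x)" by blast
  then show "\<exists>!x. x \<in> A \<and> P (h x)"
    using * assms by (intro ex1I[of _ x]) (auto dest: inj_onD)
qed

lemma loop_relabel:
  fixes Q :: "'a monoid" (structure)
  assumes h: "inj_on h (carrier Q)" and "loop Q"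
  shows "loop (relabel h Q)"
proof -
  interpret loop Q by fact
  have eq: "h u = h v \<longleftrightarrow> u = v" if "u \<in> carrier Q" "v \<in> carrier Q" for u v
    using h that by (simp add: inj_on_eq_iff)
  show ?thesis
  proof
    fix a b assume "a \<in> carrier (relabel h Q)" "b \<in> carrier (relabel h Q)"
    then obtain a' b' where ab: "a' \<in> carrier Q" "b' \<in> carrier Q" "a = h a'" "b = h b'"
      by auto
    have "\<exists>!x. x \<in> carrier Q \<and> h (a' \<otimes> x) = h b'"
      using l_division[OF ab(1,2)] ab by (simp add: eq m_closed cong: conj_cong)
    then show "\<exists>!x. x \<in> carrier (relabel h Q) \<and> a \<otimes>\<^bsub>relabel h Q\<^esub> x = b"
      using h ab by (simp add: ex1_image_iff cong: conj_cong)
    have "\<exists>!x. x \<in> carrier Q \<and> h (x \<otimes> a') = h b'"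
      using r_division[OF ab(1,2)] ab by (simp add: eq m_closed cong: conj_cong)
    then show "\<exists>!x. x \<in> carrier (relabel h Q) \<and> x \<otimes>\<^bsub>relabel h Q\<^esub> a = b"
      using h ab by (simp add: ex1_image_iff cong: conj_cong)
  qed (use h in \<open>auto simp: m_closed one_closed l_one r_one\<close>)
qed

lemma buchsteiner_loop_relabel:
  fixes Q :: "'a monoid" (structure)
  assumes h: "inj_on h (carrier Q)" and "buchsteiner_loop Q"
  shows "buchsteiner_loop (relabel h Q)"
proof -
  interpret buchsteiner_loop Q by fact
  interpret R: loop "relabel h Q"
    using h loop_axioms by (rule loop_relabel)
  show ?thesis
  proof (rule R.buchsteiner_loopI)
    fix x y z
    assume "x \<in> carrier (relabel h Q)" "y \<in> carrier (relabel h Q)" "z \<in> carrier (relabel h Q)"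
    then obtain x' y' z' where xyz: "x = h x'" "y = h y'" "z = h z'"
      and Q: "x' \<in> carrier Q" "y' \<in> carrier Q" "z' \<in> carrier Q"
      by auto
    obtain w where "w \<in> carrier Q" "x' \<otimes> w = (x' \<otimes> y') \<otimes> z'" "w \<otimes> x' = y' \<otimes> (z' \<otimes> x')"
      using buchsteiner_witness[OF Q] by blast
    then show "\<exists>w \<in> carrier (relabel h Q).
        x \<otimes>\<^bsub>relabel h Q\<^esub> w = (x \<otimes>\<^bsub>relabel h Q\<^esub> y) \<otimes>\<^bsub>relabel h Q\<^esub> z \<and>
        w \<otimes>\<^bsub>relabel h Q\<^esub> x = y \<otimes>\<^bsub>relabel h Q\<^esub> (z \<otimes>\<^bsub>relabel h Q\<^esub> x)"
      using h Q by (intro bexI[of _ "h w"]) (simp_all add: xyz m_closed)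
  qed
qed

lemma left_conjugate_relabel:
  fixes Q :: "'a monoid" (structure)
  assumes h: "inj_on h (carrier Q)" and "loop Q"
    and "conjugacy_closed_loop (relabel h Q)"
    and xy: "x \<in> carrier Q" "y \<in> carrier Q"
  shows "\<exists>w \<in> carrier Q. \<forall>z \<in> carrier Q. x \<otimes>\<^bsub>Q\<^esub> (y \<otimes>\<^bsub>Q\<^esub> z) = w \<otimes>\<^bsub>Q\<^esub> (x \<otimes>\<^bsub>Q\<^esub> z)"
proof -
  interpret loop Q by fact
  interpret R: conjugacy_closed_loop "relabel h Q" by fact
  obtain w where w: "w \<in> carrier Q" and eq: "\<And>z. z \<in> carrier Q \<Longrightarrow>
      h x \<otimes>\<^bsub>relabel h Q\<^esub> (h y \<otimes>\<^bsub>relabel h Q\<^esub> h z) = h w \<otimes>\<^bsub>relabel h Q\<^esub> (h x \<otimes>\<^bsub>relabel h Q\<^esub> h z)"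
    using R.left_conjugate[of "h x" "h y"] xy by auto
  have "x \<otimes>\<^bsub>Q\<^esub> (y \<otimes>\<^bsub>Q\<^esub> z) = w \<otimes>\<^bsub>Q\<^esub> (x \<otimes>\<^bsub>Q\<^esub> z)" if z: "z \<in> carrier Q" for z
    using eq[OF z] h xy w z by (simp add: m_closed inj_on_eq_iff[OF h])
  with w show ?thesis by blast
qed


section \<open>Central extensions of groups and their associators\<close>

locale central_extension = group G for G :: "'a monoid" (structure) +
  fixes f :: "'a \<Rightarrow> 'a \<Rightarrow> 'z::ab_group_add"
  assumes left_normalized: "x \<in> carrier G \<Longrightarrow> f \<one> x = 0"
    and right_normalized: "x \<in> carrier G \<Longrightarrow> f x \<one> = 0"
begin

definition extension :: "('a \<times> 'z) monoid"
  where "extension =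
    \<lparr>carrier = carrier G \<times> UNIV,
     mult = \<lambda>(x, a) (y, b). (x \<otimes> y, a + b + f x y),
     one = (\<one>, 0)\<rparr>"

text \<open>
  The coboundary of \<open>f\<close>: it gives the central factor by which \<open>(xy)z\<close> differs from \<open>x(yz)\<close>
  in the extension.
\<close>

definition associator :: "'a \<Rightarrow> 'a \<Rightarrow> 'a \<Rightarrow> 'z"
  where "associator x y z = f x y + f (x \<otimes> y) z - f y z - f x (y \<otimes> z)"

lemma carrier_extension [simp]: "carrier extension = carrier G \<times> UNIV"
  and one_extension [simp]: "\<one>\<^bsub>extension\<^esub> = (\<one>, 0)"
  and mult_extension [simp]:
    "(x, a) \<otimes>\<^bsub>extension\<^esub> (y, b) = (x \<otimes> y, a + b + f x y)"
  by (simp_all add: extension_def)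

lemma order_extension: "order extension = order G * card (UNIV :: 'z set)"
  by (simp add: order_def card_cartesian_product)

lemma loop_extension: "loop extension"
proof
  fix u v assume "u \<in> carrier extension" "v \<in> carrier extension"
  then obtain x a y b where uv: "u = (x, a)" "v = (y, b)" "x \<in> carrier G" "y \<in> carrier G"
    by auto
  show "\<exists>!w. w \<in> carrier extension \<and> u \<otimes>\<^bsub>extension\<^esub> w = v"
  proof (rule ex1I)
    show "(inv x \<otimes> y, b - a - f x (inv x \<otimes> y)) \<in> carrier extension \<and>
        u \<otimes>\<^bsub>extension\<^esub> (inv x \<otimes> y, b - a - f x (inv x \<otimes> y)) = v"
      using uv by (simp flip: m_assoc)
  next
    fix w assume "w \<in> carrier extension \<and> u \<otimes>\<^bsub>extension\<^esub> w = v"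
    then show "w = (inv x \<otimes> y, b - a - f x (inv x \<otimes> y))"
      using uv by (auto simp flip: m_assoc)
  qed
  show "\<exists>!w. w \<in> carrier extension \<and> w \<otimes>\<^bsub>extension\<^esub> u = v"
  proof (rule ex1I)
    show "(y \<otimes> inv x, b - a - f (y \<otimes> inv x) x) \<in> carrier extension \<and>
        (y \<otimes> inv x, b - a - f (y \<otimes> inv x) x) \<otimes>\<^bsub>extension\<^esub> u = v"
      using uv by (simp add: m_assoc)
  next
    fix w assume "w \<in> carrier extension \<and> w \<otimes>\<^bsub>extension\<^esub> u = v"
    then show "w = (y \<otimes> inv x, b - a - f (y \<otimes> inv x) x)"
      using uv by (auto simp: m_assoc)
  qed
qed (auto simp: left_normalized right_normalized)

text \<open>
  Both sides of the Buchsteiner law lie over \<open>yz\<close>. Reassociating \<open>xy\<cdot>z\<close> shows that the left side is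
  \<open>yz\<close> shifted by the associator of \<open>x, y, z\<close>, and reassociating \<open>y\<cdot>zx\<close> that the right side is
  \<open>yz\<close> shifted by minus the associator of \<open>y, z, x\<close>.
\<close>

lemma buchsteiner_loop_extension:
  assumes cyclic: "\<And>x y z. \<lbrakk>x \<in> carrier G; y \<in> carrier G; z \<in> carrier G\<rbrakk> \<Longrightarrow>
      associator x y z + associator y z x = 0"
  shows "buchsteiner_loop extension"
proof (rule loop.buchsteiner_loopI[OF loop_extension])
  fix u v t
  assume "u \<in> carrier extension" "v \<in> carrier extension" "t \<in> carrier extension"
  then obtain x a y b z c where uvt: "u = (x, a)" "v = (y, b)" "t = (z, c)"
    and G: "x \<in> carrier G" "y \<in> carrier G" "z \<in> carrier G"
    by auto
  let ?w = "(y \<otimes> z, b + c + f y z + associator x y z)"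
  have "f y z + f (y \<otimes> z) x + associator x y z = f z x + f y (z \<otimes> x)"
    using cyclic[OF G] unfolding associator_def[of y z x] by (simp add: algebra_simps)
  then have "(b + a + c) + (f y z + f (y \<otimes> z) x + associator x y z) =
      (b + a + c) + (f z x + f y (z \<otimes> x))"
    by simp
  then have "?w \<otimes>\<^bsub>extension\<^esub> u = v \<otimes>\<^bsub>extension\<^esub> (t \<otimes>\<^bsub>extension\<^esub> u)"
    using G by (simp add: uvt m_assoc ac_simps)
  moreover have "u \<otimes>\<^bsub>extension\<^esub> ?w = (u \<otimes>\<^bsub>extension\<^esub> v) \<otimes>\<^bsub>extension\<^esub> t"
    using G by (simp add: uvt m_assoc associator_def algebra_simps)
  ultimately show "\<exists>w \<in> carrier extension.
      u \<otimes>\<^bsub>extension\<^esub> w = (u \<otimes>\<^bsub>extension\<^esub> v) \<otimes>\<^bsub>extension\<^esub> t \<and>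
      w \<otimes>\<^bsub>extension\<^esub> u = v \<otimes>\<^bsub>extension\<^esub> (t \<otimes>\<^bsub>extension\<^esub> u)"
    using G by (intro bexI[of _ ?w]) auto
qed

text \<open>
  If \<open>L\<^sub>x L\<^sub>y = L\<^sub>w L\<^sub>x\<close>, then \<open>xy = wx\<close>, so that \<open>w\<close> lies over the conjugate of \<open>y\<close> by \<open>x\<close>.
  Both \<open>x\<cdot>yz\<close> and \<open>w\<cdot>xz\<close> are then reassociations of the same product \<open>xy\<cdot>z = wx\<cdot>z\<close>, and they agree
  only if the two associators do.
\<close>

lemma associator_conjugate:
  assumes x: "x \<in> carrier G" and y: "y \<in> carrier G" and z: "z \<in> carrier G"
    and conj: "\<exists>w \<in> carrier extension. \<forall>t \<in> carrier extension.
      (x, 0) \<otimes>\<^bsub>extension\<^esub> ((y, 0) \<otimes>\<^bsub>extension\<^esub> t) = w \<otimes>\<^bsub>extension\<^esub> ((x, 0) \<otimes>\<^bsub>extension\<^esub> t)"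
  shows "associator x y z = associator (x \<otimes> y \<otimes> inv x) x z"
proof -
  obtain w c where w: "w \<in> carrier G"
    and product: "\<And>t. t \<in> carrier G \<Longrightarrow>
      (x, 0) \<otimes>\<^bsub>extension\<^esub> ((y, 0) \<otimes>\<^bsub>extension\<^esub> (t, 0)) =
      (w, c) \<otimes>\<^bsub>extension\<^esub> ((x, 0) \<otimes>\<^bsub>extension\<^esub> (t, 0))"
    using conj by (force simp del: mult_extension)
  have eq: "x \<otimes> (y \<otimes> t) = w \<otimes> (x \<otimes> t) \<and> f y t + f x (y \<otimes> t) = c + f x t + f w (x \<otimes> t)"
    if "t \<in> carrier G" for t
    using product[OF that] by simp
  have xy: "x \<otimes> y = w \<otimes> x" and f_xy: "f x y = c + f w x"
    using eq[of \<one>] x y w by (auto simp: right_normalized)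
  have "w = x \<otimes> y \<otimes> inv x"
    using xy x y w by (simp add: m_assoc)
  moreover have "associator x y z = associator w x z"
    using eq[OF z] unfolding associator_def xy f_xy by (simp add: algebra_simps)
  ultimately show ?thesis by simp
qed

end


section \<open>A loop of order 32\<close>

lemma UNIV_bit: "(UNIV :: bit set) = {0, 1}"
  using bit.exhaust by auto

instance bit :: finite
  by standard (simp add: UNIV_bit)

text \<open>
  With these two rules the simplifier decides ring identities in characteristic 2. This works
  only as long as sums and products stay ring operations, so the rewriting of these to bitwise
  connectives is switched off where such identities are proved.
\<close>

lemma bit_add_self_left: "x + (x + y) = y" for x y :: bit
  by (cases x; cases y) simp_all

lemma bit_add_self: "x + x = 0" for x :: bit
  by (cases x) simp_all

text \<open>The direct product of the dihedral group of order 8 (bits \<open>a, b, d\<close>) and a group of order 2 (bit \<open>c\<close>).\<close>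

definition base_group :: "(bit \<times> bit \<times> bit \<times> bit) monoid"
  where "base_group =
    \<lparr>carrier = UNIV,
     mult = \<lambda>(a, b, c, d) (a', b', c', d'). (a + a', b + b', c + c', d + d' + a * b'),
     one = (0, 0, 0, 0)\<rparr>"

text \<open>
  The coboundary of \<open>c d'\<close> is \<open>c a' b''\<close>, because that of \<open>d\<close> is \<open>a b'\<close>. The coboundary of the function
  \<open>a c\<close> is \<open>a c' + c a'\<close>, so that of \<open>b a' c'\<close> is \<open>b c' a'' + b a' c''\<close>; likewise that of \<open>a b c'\<close> is
  \<open>a b' c'' + b a' c''\<close>. In the sum of the three the terms \<open>b a' c''\<close> cancel, and the cyclic form
  remains.
\<close>

definition cochain :: "bit \<times> bit \<times> bit \<times> bit \<Rightarrow> bit \<times> bit \<times> bit \<times> bit \<Rightarrow> bit"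
  where "cochain = (\<lambda>(a, b, c, d) (a', b', c', d'). c * d' + b * a' * c' + a * b * c')"

lemma carrier_base_group [simp]: "carrier base_group = UNIV"
  by (simp add: base_group_def)

lemma group_base_group: "group base_group"
proof (rule groupI)
  fix x assume "x \<in> carrier base_group"
  obtain a b c d where "x = (a, b, c, d)" by (cases x)
  then show "\<exists>y \<in> carrier base_group. y \<otimes>\<^bsub>base_group\<^esub> x = \<one>\<^bsub>base_group\<^esub>"
    by (intro bexI[of _ "(a, b, c, d + a * b)"])
      (auto simp add: base_group_def algebra_simps bit_add_self bit_add_self_left
        simp del: add_bit_eq_xor mult_bit_eq_and)
qed (auto simp add: base_group_def algebra_simps simp del: add_bit_eq_xor mult_bit_eq_and)

lemma order_base_group: "order base_group = 16"
  by (simp add: order_def base_group_def UNIV_bit card_cartesian_product flip: UNIV_Times_UNIV)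

interpretation B: central_extension base_group cochain
proof (intro central_extension.intro central_extension_axioms.intro group_base_group)
qed (auto simp: base_group_def cochain_def)

lemma associator_base_group:
  "B.associator (a, b, c, d) (a', b', c', d') (a'', b'', c'', d'') =
    a * b' * c'' + b * c' * a'' + c * a' * b''"
  unfolding B.associator_def
  by (simp add: base_group_def cochain_def algebra_simps
      bit_add_self bit_add_self_left del: add_bit_eq_xor mult_bit_eq_and)

theorem corollary6p2:
  "\<exists>Q :: nat monoid. buchsteiner_loop Q \<and> order Q = 32 \<and> \<not> conjugacy_closed_loop Q"
proof -
  obtain h :: "(bit \<times> bit \<times> bit \<times> bit) \<times> bit \<Rightarrow> nat" where "inj h"
    using finite_imp_inj_to_nat_seg[of "UNIV :: ((bit \<times> bit \<times> bit \<times> bit) \<times> bit) set"] by auto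
  then have h: "inj_on h (carrier B.extension)"
    by (rule inj_on_subset) simp
  have "B.associator x y z = B.associator y z x" for x y z
    by (cases x; cases y; cases z)
      (simp add: associator_base_group ac_simps del: add_bit_eq_xor mult_bit_eq_and)
  then have "buchsteiner_loop B.extension"
    by (intro B.buchsteiner_loop_extension) (metis bit_add_self)
  moreover have "order B.extension = 32"
    by (simp add: B.order_extension order_base_group UNIV_bit)
  moreover have "\<not> conjugacy_closed_loop (relabel h B.extension)"
  proof
    \<comment> \<open>Of the three terms of the form only \<open>a b' c''\<close> is nonzero at these arguments, and none is
      after the first two are exchanged; conjugation moves \<open>?y\<close> only in the bit \<open>d\<close>, which the form ignores.\<close>
    let ?x = "(1, 0, 0, 0)" and ?y = "(0, 1, 0, 0)" and ?z = "(0, 0, 1, 0)"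
    assume "conjugacy_closed_loop (relabel h B.extension)"
    then have "B.associator ?x ?y ?z =
        B.associator (?x \<otimes>\<^bsub>base_group\<^esub> ?y \<otimes>\<^bsub>base_group\<^esub> inv\<^bsub>base_group\<^esub> ?x) ?x ?z"
      by (intro B.associator_conjugate left_conjugate_relabel[OF h B.loop_extension])
        simp_all
    moreover have "?x \<otimes>\<^bsub>base_group\<^esub> ?y \<otimes>\<^bsub>base_group\<^esub> inv\<^bsub>base_group\<^esub> ?x = (0, 1, 0, 1)"
      by (rule B.inv_solve_right'[THEN iffD2]) (simp_all add: base_group_def)
    ultimately show False
      by (simp add: associator_base_group)
  qed
  ultimately show ?thesis
    using buchsteiner_loop_relabel[OF h] order_relabel[OF h] by metis
qed

end
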